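(* Let $G$ be a connected Eulerian digraph with $k$ vertices and Laplacian $L$. Let $G_n$ be the $n$-th cone over $G$ where $n\geq 2$. \begin{enumerate} \item Let $\mathbf{1}$ be the $k\times k$ matrix whose entries are all $1$, and let $I_k$ be the $k\times k$ identity matrix. Then \[ \operatorname{crit}(G_n)\simeq \left( \mathbb{Z}/(n+k)\mathbb{Z} \right)^{n-2}\oplus\operatorname{cok}(nI_k+L+\mathbf{1}). \] \item The group $\operatorname{cok}(nI_k+L+\mathbf{1})$ has a subgroup isomorphic to $\mathbb{Z}/(n+k)\mathbb{Z}$. \item The order of the critical group of $G_n$ is \[ |\operatorname{crit}(G_n)| =\frac{|p_L(-n)|}{n} (n+k)^{n-1} \] where $p_L$ is the characteristic polynomial of $L$. \end{enumerate}
   Context: $G$ is a connected Eulerian digraph (indegree equals outdegree at every vertex; undirected graphs are a special case; loops and multiple edges allowed) with finite vertex set $V$, $|V|=k$. The Laplacian $L\colon\mathbb{Z}V\to\mathbb{Z}V$ is given by $L(v)=\mathrm{outdeg}(v)\,v-\sum_{(v,w)\in E}w$; as a $k\times k$ matrix, $L=D-A^t$ with $D$ the diagonal matrix of outdegrees and $A$ the directed adjacency matrix. With $\delta\colon\mathbb{Z}V\to\mathbb{Z}$ the degree map $\delta(v)=1$, the critical group is $\operatorname{crit}(G)=\ker\delta/\operatorname{im}L$. The $n$-th iterated cone $G_n$ is the join of $G$ and the complete graph $K_n$, formed by connecting each vertex of $G$ to each vertex of $K_n$ by an undirected edge. $\operatorname{cok}(X)$ denotes the cokernel of the integer matrix $X$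 acting on $\mathbb{Z}^k$. *)

theory Defs
  imports
    "HOL-Algebra.Free_Abelian_Groups"
    "Graph_Theory.Graph_Theory"
    "Jordan_Normal_Form.Char_Poly"
begin

definition eulerian :: "('a, 'b) pre_digraph \<Rightarrow> bool" where
  "eulerian G \<longleftrightarrow> (\<forall>v\<in>verts G. in_degree G v = out_degree G v)"

definition degree_map :: "('a \<Rightarrow>\<^sub>0 int) \<Rightarrow> int" where
  "degree_map c = (\<Sum>v\<in>Poly_Mapping.keys c. Poly_Mapping.lookup c v)"

definition laplacian :: "('a, 'b) pre_digraph \<Rightarrow> ('a \<Rightarrow>\<^sub>0 int) \<Rightarrow> ('a \<Rightarrow>\<^sub>0 int)" where
  "laplacian G = frag_extend (\<lambda>v. frag_cmul (int (out_degree G v)) (frag_of v)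
                                - (\<Sum>e\<in>out_arcs G v. frag_of (head G e)))"

definition crit :: "('a, 'b) pre_digraph \<Rightarrow> ('a \<Rightarrow>\<^sub>0 int) set monoid" where
  "crit G = (free_Abelian_group (verts G))
              \<lparr>carrier := kernel (free_Abelian_group (verts G)) integer_group degree_map\<rparr>
            Mod (laplacian G ` carrier (free_Abelian_group (verts G)))"

text \<open>
  Undirected edges are represented by pairs of opposite arcs, both in \<open>complete_graph\<close>
  and for the connecting edges of \<open>graph_join\<close>.
\<close>

definition complete_graph :: "nat \<Rightarrow> (nat, nat \<times> nat) pre_digraph" where
  "complete_graph n =
     \<lparr>verts = {..<n}, arcs = {(i, j). i < n \<and> j < n \<and> i \<noteq> j}, tail = fst, head = snd\<rparr>"

definition graph_join :: "('a, 'b) pre_digraph \<Rightarrow> ('c, 'd) pre_digraph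
    \<Rightarrow> ('a + 'c, ('b + 'd) + ('a \<times> 'c) + ('c \<times> 'a)) pre_digraph" where
  "graph_join G H =
     \<lparr>verts = verts G <+> verts H,
      arcs = (arcs G <+> arcs H) <+> (verts G \<times> verts H <+> verts H \<times> verts G),
      tail = case_sum (map_sum (tail G) (tail H)) (map_sum fst fst),
      head = case_sum (map_sum (head G) (head H)) (case_sum (Inr \<circ> snd) (Inl \<circ> snd))\<rparr>"

definition iterated_cone :: "nat \<Rightarrow> ('a, 'b) pre_digraph
    \<Rightarrow> ('a + nat, ('b + nat \<times> nat) + ('a \<times> nat) + (nat \<times> 'a)) pre_digraph" where
  "iterated_cone n G = graph_join G (complete_graph n)"

text \<open>
  The matrices are taken with respect to an enumeration \<open>vs\<close> of the vertices without repetitions.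
\<close>

definition adjacency_mat :: "('a, 'b) pre_digraph \<Rightarrow> 'a list \<Rightarrow> int mat" where
  "adjacency_mat G vs = mat (length vs) (length vs)
     (\<lambda>(i, j). int (card {e \<in> arcs G. tail G e = vs ! i \<and> head G e = vs ! j}))"

definition outdegree_mat :: "('a, 'b) pre_digraph \<Rightarrow> 'a list \<Rightarrow> int mat" where
  "outdegree_mat G vs = mat (length vs) (length vs)
     (\<lambda>(i, j). if i = j then int (out_degree G (vs ! i)) else 0)"

definition laplacian_mat :: "('a, 'b) pre_digraph \<Rightarrow> 'a list \<Rightarrow> int mat" where
  "laplacian_mat G vs = outdegree_mat G vs - transpose_mat (adjacency_mat G vs)"

definition ones_mat :: "nat \<Rightarrow> int mat" where
  "ones_mat k = mat k k (\<lambda>_. 1)"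

definition cok :: "int mat \<Rightarrow> int vec set monoid" where
  "cok X = add_monoid (module_vec TYPE(int) (dim_row X))
           Mod ((\<lambda>v. X *\<^sub>v v) ` carrier_vec (dim_col X))"

lemma lookup_laplacian_frag_of:
  assumes "fin_digraph G" "distinct vs" "i < length vs" "j < length vs"
  shows "Poly_Mapping.lookup (laplacian G (frag_of (vs ! j))) (vs ! i) = laplacian_mat G vs $$ (i, j)"
proof -
  interpret fin_digraph G by fact
  have "Poly_Mapping.lookup (\<Sum>e\<in>out_arcs G (vs ! j). frag_of (head G e)) (vs ! i)
      = (\<Sum>e\<in>out_arcs G (vs ! j). if head G e = vs ! i then 1 else 0)"
    by (auto simp: lookup_sum lookup_single when_def intro!: sum.cong)
  also have "\<dots> = int (card {e \<in> out_arcs G (vs ! j). head G e = vs ! i})"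
    by (subst sum.inter_filter [symmetric]) (rule finite_out_arcs, simp only: card_eq_sum of_nat_sum of_nat_1)
  also have "{e \<in> out_arcs G (vs ! j). head G e = vs ! i}
      = {e \<in> arcs G. tail G e = vs ! j \<and> head G e = vs ! i}"
    by (auto simp: out_arcs_def)
  finally show ?thesis
    using assms(2-4)
    by (auto simp: laplacian_def laplacian_mat_def outdegree_mat_def adjacency_mat_def
        lookup_minus lookup_single when_def nth_eq_iff_index_eq)
qed

end

theory Submission
  imports Defs
begin

text \<open>
  Let \<open>N = n + k\<close>, \<open>M = n I + L + 1\<close>, and let \<open>x\<^sub>0, \<dots>, x\<^sub>n\<^sub>-\<^sub>1\<close> be the vertices of \<open>K\<^sub>n\<close>.  For a
  degree 0 chain \<open>c\<close> on the cone consider the differences \<open>c(x\<^sub>i) - c(x\<^sub>0)\<close> modulo \<open>N\<close> for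
  \<open>1 \<le> i \<le> n - 2\<close>, and the class in \<open>cok M\<close> of the function \<open>v \<mapsto> c(v) - c(x\<^sub>0)\<close> on the vertices
  of \<open>G\<close>.  The coordinate \<open>c(x\<^sub>n\<^sub>-\<^sub>1)\<close> is free to balance the degree, so this homomorphism is onto.
  Its kernel is the image of the Laplacian of the cone: if \<open>f\<close> is the restriction of \<open>b\<close> to \<open>G\<close>, then
  the Laplacian of \<open>b\<close> is sent to the numbers \<open>N (b(x\<^sub>i) - b(x\<^sub>0))\<close> and to \<open>M (f - b(x\<^sub>0))\<close>, because \<open>L\<close>
  annihilates constants.

  By the maximum principle \<open>M u = m 1\<close> forces \<open>u\<close> to be constant, hence \<open>M\<close> is nonsingular and the
  class of \<open>1\<close> in \<open>cok M\<close> has order exactly \<open>N\<close>.  The order of \<open>cok M\<close> is \<open>|det M|\<close>, by reduction to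
  a triangular matrix, and \<open>n det M = N det (n I + L)\<close>.
\<close>

section \<open>Index of the image of an integer matrix\<close>

definition mat_image :: "int mat \<Rightarrow> int vec set" where
  "mat_image X = (\<lambda>v. X *\<^sub>v v) ` carrier_vec (dim_col X)"

text \<open>Coset representatives are kept as vectors, not as cosets, so that the first coordinate
  can be split off when the matrix shrinks; the size of \<open>R\<close> is the index of the
  image.\<close>

definition transversal :: "int mat \<Rightarrow> int vec set \<Rightarrow> bool" where
  "transversal X R \<longleftrightarrow> R \<subseteq> carrier_vec (dim_row X) \<and>
     (\<forall>x\<in>carrier_vec (dim_row X). \<exists>!r. r \<in> R \<and> x - r \<in> mat_image X)"

section \<open>Column operations and the image of a matrix\<close>

lemma mat_image_mult_subset:
  assumes "A \<in> carrier_mat m k" "P \<in> carrier_mat k k"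
  shows "mat_image (A * P) \<subseteq> mat_image A"
proof
  fix y assume "y \<in> mat_image (A * P)"
  then obtain v where v: "v \<in> carrier_vec k" "y = A * P *\<^sub>v v"
    using assms by (auto simp: mat_image_def)
  then have "y = A *\<^sub>v (P *\<^sub>v v)" "P *\<^sub>v v \<in> carrier_vec k"
    using assms by auto
  then show "y \<in> mat_image A" using assms by (auto simp: mat_image_def)
qed

text \<open>A column operation is right multiplication by an integer matrix, which can only shrink
  the image. Its inverse is an operation of the same kind and gives the other inclusion.\<close>

lemma mat_image_addcol:
  assumes A: "A \<in> carrier_mat m k" and "i < k" "j < k" "i \<noteq> j"
  shows "mat_image (addcol a i j A) = mat_image A"
proof -
  have sub: "mat_image (addcol b i j B) \<subseteq> mat_image B" if "B \<in> carrier_mat m k" for b B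
    using mat_image_mult_subset[OF that addrow_mat_carrier[of k b j i]]
      addcol_mat[OF that \<open>j < k\<close>, of b i] by simp
  have "addcol (- a) i j (addcol a i j A) = A"
    using assms by (intro eq_matI) auto
  moreover have "addcol a i j A \<in> carrier_mat m k"
    using A by (simp add: mat_addcol_def)
  ultimately show ?thesis
    using sub[OF A, of a] sub[of "addcol a i j A" "- a"] by simp
qed

lemma mat_image_swapcols:
  assumes A: "A \<in> carrier_mat m k" and "i < k" "j < k"
  shows "mat_image (swapcols i j A) = mat_image A"
proof -
  have sub: "mat_image (swapcols i j B) \<subseteq> mat_image B" if "B \<in> carrier_mat m k" for B
    using mat_image_mult_subset[OF that swaprows_mat_carrier[of k i j]]
      swapcols_mat[OF that \<open>i < k\<close> \<open>j < k\<close>] by simp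
  have "swapcols i j (swapcols i j A) = A"
    using assms by (intro eq_matI) auto
  then show ?thesis
    using sub[OF A] sub[of "swapcols i j A"] A by simp
qed

text \<open>One step of the subtractive Euclidean algorithm: the sign makes the smaller entry move
  the larger one towards zero without crossing it.\<close>

lemma abs_diff_sgn_mult:
  fixes a b :: int
  assumes "a \<noteq> 0" "b \<noteq> 0" "\<bar>b\<bar> \<le> \<bar>a\<bar>"
  shows "\<bar>- (sgn a * sgn b) * b + a\<bar> < \<bar>a\<bar>"
  using assms by (cases "a > 0"; cases "b > 0") (auto simp: sgn_if)

text \<open>The Euclidean algorithm on the first row by column operations, with the sum of the
  absolute values of that row as decreasing measure. The final exchange of columns may flip the sign
  of the determinant.\<close>

lemma clear_first_row:
  assumes "A \<in> carrier_mat (Suc k) (Suc k)"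
  shows "\<exists>B. B \<in> carrier_mat (Suc k) (Suc k) \<and> mat_image B = mat_image A
     \<and> \<bar>det B\<bar> = \<bar>det A\<bar> \<and> (\<forall>j. 0 < j \<longrightarrow> j < Suc k \<longrightarrow> B $$ (0, j) = 0)"
  using assms
proof (induction "\<Sum>j<Suc k. nat \<bar>A $$ (0, j)\<bar>" arbitrary: A rule: less_induct)
  case less
  note A = less.prems
  show ?case
  proof (cases "\<exists>i j. i < Suc k \<and> j < Suc k \<and> i \<noteq> j \<and> A $$ (0, i) \<noteq> 0 \<and> A $$ (0, j) \<noteq> 0")
    case True
    then obtain i j where ij: "i < Suc k" "j < Suc k" "i \<noteq> j" "A $$ (0, i) \<noteq> 0" "A $$ (0, j) \<noteq> 0"
        "\<bar>A $$ (0, j)\<bar> \<le> \<bar>A $$ (0, i)\<bar>"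
      by (metis linear)
    define a where "a = - (sgn (A $$ (0, i)) * sgn (A $$ (0, j)))"
    define B where "B = addcol a i j A"
    have B: "B \<in> carrier_mat (Suc k) (Suc k)" using A by (simp add: B_def mat_addcol_def)
    have "(\<Sum>l<Suc k. nat \<bar>B $$ (0, l)\<bar>) < (\<Sum>l<Suc k. nat \<bar>A $$ (0, l)\<bar>)"
    proof (rule sum_strict_mono_ex1)
      show "\<forall>l\<in>{..<Suc k}. nat \<bar>B $$ (0, l)\<bar> \<le> nat \<bar>A $$ (0, l)\<bar>"
        using A ij abs_diff_sgn_mult[OF ij(4-6)] by (auto simp: B_def a_def)
      show "\<exists>l\<in>{..<Suc k}. nat \<bar>B $$ (0, l)\<bar> < nat \<bar>A $$ (0, l)\<bar>"
        using A ij abs_diff_sgn_mult[OF ij(4-6)] by (intro bexI[of _ i]) (auto simp: B_def a_def)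
    qed auto
    from less.hyps[OF this B] show ?thesis
      using mat_image_addcol[OF A ij(1-3)] det_addcol[OF ij(2,3) A] by (simp add: B_def)
  next
    case one: False
    show ?thesis
    proof (cases "\<exists>i. 0 < i \<and> i < Suc k \<and> A $$ (0, i) \<noteq> 0")
      case True
      then obtain i where i: "0 < i" "i < Suc k" "A $$ (0, i) \<noteq> 0" by blast
      \<comment> \<open>Column \<open>i\<close> holds the only nonzero entry of the first row, so
        the exchange leaves zeros behind the corner.\<close>
      have "swapcols 0 i A $$ (0, j) = 0" if "0 < j" "j < Suc k" for j
        using A i one that by (metis carrier_matD index_mat_swapcols(1) less_not_refl zero_less_Suc)
      then show ?thesis
        using A i mat_image_swapcols[OF A _ i(2), of 0] det_swapcols[OF _ i(2) _ A, of 0]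
        by (intro exI[of _ "swapcols 0 i A"]) auto
    next
      case False
      then show ?thesis using A by blast
    qed
  qed
qed

section \<open>Coset representatives by induction on the size of the matrix\<close>

lemma transversal_cong:
  assumes "mat_image A = mat_image B" "dim_row A = dim_row B"
  shows "transversal A R \<longleftrightarrow> transversal B R"
  using assms by (simp add: transversal_def)

lemma mult_mat_vCons:
  fixes B :: "int mat"
  assumes "B \<in> carrier_mat (Suc k) (Suc k)" "w \<in> carrier_vec k"
    "\<And>j. 0 < j \<Longrightarrow> j < Suc k \<Longrightarrow> B $$ (0, j) = 0"
  shows "B *\<^sub>v vCons q w = vCons (B $$ (0, 0) * q)
    (q \<cdot>\<^sub>v vec k (\<lambda>i. B $$ (Suc i, 0)) + mat k k (\<lambda>(i, j). B $$ (Suc i, Suc j)) *\<^sub>v w)"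
  (is "?l = ?r")
proof (rule eq_vecI)
  fix i assume "i < dim_vec ?r"
  then have i: "i < Suc k" by simp
  have "?l $ i = (\<Sum>j<Suc k. B $$ (i, j) * vCons q w $ j)"
    using assms i by (simp add: scalar_prod_def lessThan_atLeast0)
  also have "\<dots> = B $$ (i, 0) * q + (\<Sum>j<k. B $$ (i, Suc j) * w $ j)"
    by (subst sum.lessThan_Suc_shift) simp
  also have "\<dots> = ?r $ i"
    using assms i by (cases i) (auto simp: scalar_prod_def lessThan_atLeast0)
  finally show "?l $ i = ?r $ i" .
qed (use assms in auto)

text \<open>The first coordinate of an image vector is \<open>g * q\<close>, and it determines
  \<open>q\<close> since \<open>g\<close> is nonzero. After subtracting \<open>q\<close> times the
  rest of the first column, the other coordinates must lie in the image of the lower right block.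
  Hence a residue modulo \<open>g\<close> and a representative for that block can be chosen
  independently.\<close>

lemma transversal_block:
  assumes B: "B \<in> carrier_mat (Suc k) (Suc k)"
    and z: "\<And>j. 0 < j \<Longrightarrow> j < Suc k \<Longrightarrow> B $$ (0, j) = 0"
    and g: "B $$ (0, 0) = g" "g \<noteq> 0"
    and R: "transversal (mat k k (\<lambda>(i, j). B $$ (Suc i, Suc j))) R"
  shows "transversal B (case_prod vCons ` ({0..<\<bar>g\<bar>} \<times> R))"
proof -
  define N where "N = mat k k (\<lambda>(i, j). B $$ (Suc i, Suc j))"
  define c where "c = vec k (\<lambda>i. B $$ (Suc i, 0))"
  have N: "N \<in> carrier_mat k k" and c: "c \<in> carrier_vec k" by (auto simp: N_def c_def)
  have RN: "R \<subseteq> carrier_vec k" "\<And>x. x \<in> carrier_vec k \<Longrightarrow> \<exists>!r. r \<in> R \<and> x - r \<in> mat_image N"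
    using R N unfolding N_def[symmetric] transversal_def by auto
  have im: "vCons a v \<in> mat_image B \<longleftrightarrow> (\<exists>q. a = g * q \<and> v - q \<cdot>\<^sub>v c \<in> mat_image N)"
    if v: "v \<in> carrier_vec k" for a v
  proof
    assume "vCons a v \<in> mat_image B"
    then obtain u where u: "u \<in> carrier_vec (Suc k)" "vCons a v = B *\<^sub>v u"
      using B by (auto simp: mat_image_def)
    obtain q w where qw: "u = vCons q w" "w \<in> carrier_vec k"
      using u(1) by (cases u) (auto simp: zero_vec_def)
    with u have "a = g * q" "v = q \<cdot>\<^sub>v c + N *\<^sub>v w"
      using mult_mat_vCons[OF B qw(2) z] g by (simp_all add: c_def N_def)
    moreover have "q \<cdot>\<^sub>v c + N *\<^sub>v w - q \<cdot>\<^sub>v c = N *\<^sub>v w"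
      using c N qw(2) by (intro eq_vecI) auto
    ultimately show "\<exists>q. a = g * q \<and> v - q \<cdot>\<^sub>v c \<in> mat_image N"
      using qw(2) N by (auto simp: mat_image_def)
  next
    assume "\<exists>q. a = g * q \<and> v - q \<cdot>\<^sub>v c \<in> mat_image N"
    then obtain q w where q: "a = g * q" "v - q \<cdot>\<^sub>v c = N *\<^sub>v w" "w \<in> carrier_vec k"
      using N by (auto simp: mat_image_def)
    have "v = q \<cdot>\<^sub>v c + (v - q \<cdot>\<^sub>v c)" using v c by (intro eq_vecI) auto
    with q have "vCons a v = B *\<^sub>v vCons q w"
      using mult_mat_vCons[OF B q(3) z] g by (simp add: c_def N_def)
    then show "vCons a v \<in> mat_image B"
      using B q(3) by (auto simp: mat_image_def)
  qed
  have minus: "vCons a v - vCons b w = vCons (a - b) (v - w)"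
    if "v \<in> carrier_vec k" "w \<in> carrier_vec k" for a b :: int and v w :: "int vec"
    using that by (intro eq_vecI) (auto simp: vec_index_vCons)
  have swap: "x - r - q \<cdot>\<^sub>v c = x - q \<cdot>\<^sub>v c - r" if "x \<in> carrier_vec k" "r \<in> carrier_vec k" for x r q
    using that c by (intro eq_vecI) auto
  have "\<exists>!r. r \<in> case_prod vCons ` ({0..<\<bar>g\<bar>} \<times> R) \<and> x - r \<in> mat_image B"
    if xk: "x \<in> carrier_vec (Suc k)" for x
  proof -
    obtain a v where x: "x = vCons a v" "v \<in> carrier_vec k"
      using xk by (cases x) auto
    define s where "s = a mod \<bar>g\<bar>"
    have s: "s \<in> {0..<\<bar>g\<bar>}" using g by (simp add: s_def)
    have "g dvd a - s" by (metis abs_dvd_iff dvd_minus_mod s_def)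
    then obtain q where q: "a - s = g * q" by auto
    have vq: "v - q \<cdot>\<^sub>v c \<in> carrier_vec k" using x c by auto
    then obtain r where r: "r \<in> R" "v - q \<cdot>\<^sub>v c - r \<in> mat_image N"
      using RN(2) by blast
    have rk: "r \<in> carrier_vec k" using r RN by auto
    show ?thesis
    proof (rule ex1I[of _ "vCons s r"])
      show "vCons s r \<in> case_prod vCons ` ({0..<\<bar>g\<bar>} \<times> R) \<and> x - vCons s r \<in> mat_image B"
        using s r q x rk swap im[of "v - r" "a - s"] by (auto simp: minus)
    next
      fix y assume y: "y \<in> case_prod vCons ` ({0..<\<bar>g\<bar>} \<times> R) \<and> x - y \<in> mat_image B"
      then obtain s' r' where y': "y = vCons s' r'" "s' \<in> {0..<\<bar>g\<bar>}" "r' \<in> R" by auto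
      have rk': "r' \<in> carrier_vec k" using y' RN by auto
      obtain q' where q': "a - s' = g * q'" "v - q' \<cdot>\<^sub>v c - r' \<in> mat_image N"
        using y im[of "v - r'" "a - s'"] x rk' swap by (auto simp: y' minus)
      have "s' = s' mod \<bar>g\<bar>" using y' by simp
      also have "\<dots> = a mod \<bar>g\<bar>"
        using q'(1) by (metis abs_dvd_iff dvd_triv_left mod_eq_dvd_iff)
      finally have "s' = s" by (simp add: s_def)
      \<comment> \<open>Equal residues and cancellation of \<open>g\<close> give the same multiple
        of \<open>c\<close>, so uniqueness is inherited from \<open>N\<close>.\<close>
      then have "q' = q" using q q' g by simp
      then show "y = vCons s r" using y' q'(2) r RN(2)[OF vq] \<open>s' = s\<close> by blast
    qed
  qed
  moreover have "case_prod vCons ` ({0..<\<bar>g\<bar>} \<times> R) \<subseteq> carrier_vec (Suc k)" using RN by auto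
  ultimately show ?thesis using B by (auto simp: transversal_def)
qed

lemma det_first_row_cleared:
  fixes B :: "int mat"
  assumes B: "B \<in> carrier_mat (Suc k) (Suc k)"
    and z: "\<And>j. 0 < j \<Longrightarrow> j < Suc k \<Longrightarrow> B $$ (0, j) = 0"
  shows "det B = B $$ (0, 0) * det (mat k k (\<lambda>(i, j). B $$ (Suc i, Suc j)))"
proof -
  have "B = four_block_mat (mat 1 1 (\<lambda>_. B $$ (0, 0))) (0\<^sub>m 1 k)
      (mat k 1 (\<lambda>(i, _). B $$ (Suc i, 0))) (mat k k (\<lambda>(i, j). B $$ (Suc i, Suc j)))"
    using B z by (intro eq_matI) auto
  then have "det B = det (mat 1 1 (\<lambda>_. B $$ (0, 0))) * det (mat k k (\<lambda>(i, j). B $$ (Suc i, Suc j)))"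
    using det_four_block_mat_upper_right_zero[OF mat_carrier refl mat_carrier mat_carrier] by metis
  then show ?thesis by (simp add: det_single)
qed

text \<open>Once the first row is cleared, the absolute determinant and the number of
  representatives factor in the same way, into corner entry and remaining block. Nonsingularity
  keeps the corner nonzero, as division with remainder requires.\<close>

lemma exists_transversal:
  assumes "A \<in> carrier_mat k k" "det A \<noteq> 0"
  shows "\<exists>R. transversal A R \<and> finite R \<and> int (card R) = \<bar>det A\<bar>"
  using assms
proof (induction k arbitrary: A)
  case 0
  have "x - 0\<^sub>v 0 \<in> mat_image A" if "x \<in> carrier_vec 0" for x
    unfolding mat_image_def using 0 that by (intro image_eqI[of _ _ x] eq_vecI) auto
  with 0 have "transversal A {0\<^sub>v 0}" by (auto simp: transversal_def)
  with 0 show ?case by (intro exI[of _ "{0\<^sub>v 0}"]) (auto simp: det_dim_zero)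
next
  case (Suc k)
  from clear_first_row[OF Suc.prems(1)] obtain B where
    B: "B \<in> carrier_mat (Suc k) (Suc k)" "mat_image B = mat_image A" "\<bar>det B\<bar> = \<bar>det A\<bar>"
    and z: "\<And>j. 0 < j \<Longrightarrow> j < Suc k \<Longrightarrow> B $$ (0, j) = 0" by blast
  let ?N = "mat k k (\<lambda>(i, j). B $$ (Suc i, Suc j))"
  have det: "det B = B $$ (0, 0) * det ?N" by (rule det_first_row_cleared[OF B(1) z])
  with B Suc.prems have "B $$ (0, 0) \<noteq> 0" "det ?N \<noteq> 0" by auto
  from Suc.IH[OF mat_carrier this(2)] obtain R where
    R: "transversal ?N R" "finite R" "int (card R) = \<bar>det ?N\<bar>" by blast
  let ?R = "case_prod vCons ` ({0..<\<bar>B $$ (0, 0)\<bar>} \<times> R)"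
  have "transversal A ?R"
    using transversal_block[OF B(1) z refl \<open>B $$ (0, 0) \<noteq> 0\<close> R(1)] transversal_cong[OF B(2)] B(1) Suc.prems
    by auto
  moreover have "int (card ?R) = \<bar>det A\<bar>"
    by (subst card_image) (auto simp: inj_on_def card_cartesian_product R det abs_mult B(3)[symmetric])
  ultimately show ?case using R(2) by blast
qed

section \<open>Cokernels\<close>

text \<open>A name for the additive group that \<open>cok\<close> divides, so that coset theory,
  which is stated multiplicatively, gets its own simplification rules.\<close>

definition vec_group where
  "vec_group k = add_monoid (module_vec TYPE(int) k)"

definition cok_class :: "int mat \<Rightarrow> int vec \<Rightarrow> int vec set" where
  "cok_class X v = mat_image X #>\<^bsub>vec_group (dim_row X)\<^esub> v"

lemma vec_group_simps [simp]:
  "carrier (vec_group k) = carrier_vec k"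
  "x \<otimes>\<^bsub>vec_group k\<^esub> y = x + y"
  "\<one>\<^bsub>vec_group k\<^esub> = 0\<^sub>v k"
  by (simp_all add: vec_group_def module_vec_simps)

lemma comm_group_vec_group: "comm_group (vec_group k)"
proof (rule comm_groupI)
  fix x assume "x \<in> carrier (vec_group k)"
  then show "\<exists>y\<in>carrier (vec_group k). y \<otimes>\<^bsub>vec_group k\<^esub> x = \<one>\<^bsub>vec_group k\<^esub>"
    by (intro bexI[of _ "- x"]) auto
qed (auto simp: comm_add_vec)

lemma inv_vec_group [simp]:
  assumes "v \<in> carrier_vec k"
  shows "inv\<^bsub>vec_group k\<^esub> v = - v"
proof -
  interpret comm_group "vec_group k" by (rule comm_group_vec_group)
  show ?thesis using assms by (intro inv_equality) auto
qed

context
  fixes X :: "int mat" and k :: nat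
  assumes X: "X \<in> carrier_mat k k"
begin

lemma mat_image_closed: "x \<in> mat_image X \<Longrightarrow> x \<in> carrier_vec k"
  using X by (auto simp: mat_image_def)

lemma subgroup_mat_image: "subgroup (mat_image X) (vec_group k)"
proof -
  interpret comm_group "vec_group k" by (rule comm_group_vec_group)
  show ?thesis
  proof (rule subgroupI)
    show "mat_image X \<subseteq> carrier (vec_group k)" using mat_image_closed by auto
    show "mat_image X \<noteq> {}" unfolding mat_image_def using zero_carrier_vec by blast
  next
    fix a assume "a \<in> mat_image X"
    then obtain v where v: "v \<in> carrier_vec k" "a = X *\<^sub>v v"
      using X by (auto simp: mat_image_def)
    moreover have "- (X *\<^sub>v v) = X *\<^sub>v (- v)"
      using X v by (intro eq_vecI) auto
    ultimately show "inv\<^bsub>vec_group k\<^esub> a \<in> mat_image X"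
      using X by (auto simp: mat_image_def)
  next
    fix a b assume "a \<in> mat_image X" "b \<in> mat_image X"
    then obtain v w where v: "v \<in> carrier_vec k" "a = X *\<^sub>v v" "w \<in> carrier_vec k" "b = X *\<^sub>v w"
      using X by (auto simp: mat_image_def)
    then have "a + b = X *\<^sub>v (v + w)"
      using X mult_add_distrib_mat_vec by metis
    then show "a \<otimes>\<^bsub>vec_group k\<^esub> b \<in> mat_image X"
      using X v by (auto simp: mat_image_def)
  qed
qed

lemma normal_mat_image: "mat_image X \<lhd> vec_group k"
  by (rule comm_group.subgroup_imp_normal[OF comm_group_vec_group subgroup_mat_image])

lemma cok_eq: "cok X = vec_group k Mod mat_image X"
  using X by (simp add: cok_def vec_group_def mat_image_def)

lemma group_cok: "group (cok X)"
  unfolding cok_eq by (rule normal.factorgroup_is_group[OF normal_mat_image])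

lemma carrier_cok: "carrier (cok X) = cok_class X ` carrier_vec k"
  unfolding cok_eq using X by (auto simp: FactGroup_def RCOSETS_def cok_class_def)

lemma one_cok: "\<one>\<^bsub>cok X\<^esub> = mat_image X"
  unfolding cok_eq by (simp add: FactGroup_def)

lemma mult_cok:
  assumes "v \<in> carrier_vec k" "w \<in> carrier_vec k"
  shows "cok_class X v \<otimes>\<^bsub>cok X\<^esub> cok_class X w = cok_class X (v + w)"
  using normal.rcos_sum[OF normal_mat_image] assms X
  by (simp add: cok_eq FactGroup_def cok_class_def)

lemma cok_class_eq_iff:
  assumes "v \<in> carrier_vec k" "w \<in> carrier_vec k"
  shows "cok_class X v = cok_class X w \<longleftrightarrow> v - w \<in> mat_image X"
proof -
  interpret comm_group "vec_group k" by (rule comm_group_vec_group)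
  have "cok_class X v = cok_class X w \<longleftrightarrow> v \<in> mat_image X #>\<^bsub>vec_group k\<^esub> w"
    unfolding cok_class_def using X assms repr_independence[OF _ _ subgroup_mat_image]
      repr_independenceD[OF subgroup_mat_image] by (metis carrier_matD(1) vec_group_simps(1))
  also have "\<dots> \<longleftrightarrow> v - w \<in> mat_image X"
  proof
    assume "v \<in> mat_image X #>\<^bsub>vec_group k\<^esub> w"
    then obtain u where "u \<in> mat_image X" "v = u + w" by (auto simp: r_coset_def)
    moreover from this have "u + w - w = u"
      using assms mat_image_closed[of u] by (intro eq_vecI) auto
    ultimately show "v - w \<in> mat_image X" by simp
  next
    assume "v - w \<in> mat_image X"
    moreover have "v = (v - w) + w" using assms by (intro eq_vecI) auto
    ultimately show "v \<in> mat_image X #>\<^bsub>vec_group k\<^esub> w" by (auto simp: r_coset_def)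
  qed
  finally show ?thesis .
qed

lemma cok_class_eq_one_iff:
  assumes "v \<in> carrier_vec k"
  shows "cok_class X v = \<one>\<^bsub>cok X\<^esub> \<longleftrightarrow> v \<in> mat_image X"
proof -
  interpret comm_group "vec_group k" by (rule comm_group_vec_group)
  have "cok_class X (0\<^sub>v k) = mat_image X"
    using X coset_mult_one[of "mat_image X"] mat_image_closed by (auto simp: cok_class_def)
  then show ?thesis
    using cok_class_eq_iff[OF assms zero_carrier_vec] assms by (simp add: one_cok)
qed

text \<open>A transversal meets every coset exactly once, so \<open>cok_class X\<close> maps it
  bijectively onto the cokernel.\<close>

theorem card_cok:
  assumes "det X \<noteq> 0"
  shows "finite (carrier (cok X))" "int (Coset.order (cok X)) = \<bar>det X\<bar>"
proof -
  obtain R where R: "transversal X R" "finite R" "int (card R) = \<bar>det X\<bar>"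
    using exists_transversal[OF X assms] by blast
  have Rk: "R \<subseteq> carrier_vec k" and R1: "\<And>x. x \<in> carrier_vec k \<Longrightarrow> \<exists>!r. r \<in> R \<and> x - r \<in> mat_image X"
    using R(1) X by (auto simp: transversal_def)
  have zero: "r - r \<in> mat_image X" if "r \<in> carrier_vec k" for r
    using cok_class_eq_iff[OF that that] by simp
  have "inj_on (cok_class X) R"
  proof (rule inj_onI)
    fix r s assume rs: "r \<in> R" "s \<in> R" "cok_class X r = cok_class X s"
    then have "r \<in> carrier_vec k" "s \<in> carrier_vec k" using Rk by auto
    with rs have "r - s \<in> mat_image X" using cok_class_eq_iff by blast
    then show "r = s" using R1[of r] rs zero Rk by blast
  qed
  moreover have "carrier (cok X) = cok_class X ` R"
  proof -
    have "cok_class X x \<in> cok_class X ` R" if "x \<in> carrier_vec k" for x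
      using R1[OF that] cok_class_eq_iff[OF that] Rk by blast
    then show ?thesis using Rk by (auto simp: carrier_cok)
  qed
  ultimately show "finite (carrier (cok X))" "int (Coset.order (cok X)) = \<bar>det X\<bar>"
    using R by (auto simp: Coset.order_def card_image)
qed

end

text \<open>\<open>B + 1 1\<^sup>T\<close> is the Schur complement of the block matrix \<open>P = [[1, -1\<^sup>T], [1, B]]\<close>; the common
  row sum \<open>b\<close> allows to clear the lower left block of \<open>P\<close> as well.\<close>
lemma det_add_ones_mat:
  fixes B :: "int mat" and b :: int
  assumes B: "B \<in> carrier_mat k k"
    and rows: "\<And>i. i < k \<Longrightarrow> (\<Sum>j<k. B $$ (i, j)) = b"
  shows "b * det (B + ones_mat k) = (b + int k) * det B"
proof -
  let ?c = "\<lambda>x. mat 1 1 (\<lambda>_. x) :: int mat"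
  let ?u = "\<lambda>x. mat 1 k (\<lambda>_. x) :: int mat"
  let ?w = "\<lambda>x. mat k 1 (\<lambda>_. x) :: int mat"
  let ?P = "four_block_mat (?c 1) (?u (-1)) (?w 1) B"
  let ?Q = "four_block_mat (?c 1) (?u 1) (0\<^sub>m k 1) (1\<^sub>m k)"
  let ?S = "four_block_mat (?c b) (0\<^sub>m 1 k) (?w (-1)) (1\<^sub>m k)"
  have P: "?P \<in> carrier_mat (1 + k) (1 + k)" and Q: "?Q \<in> carrier_mat (1 + k) (1 + k)"
    and S: "?S \<in> carrier_mat (1 + k) (1 + k)" using B by auto
  \<comment> \<open>Multiplication by \<open>?Q\<close> adds the first column to all others. It
    clears the upper right block and has determinant 1.\<close>
  have PQ: "?P * ?Q = four_block_mat (?c 1) (0\<^sub>m 1 k) (?w 1) (B + ones_mat k)"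
    by (subst mult_four_block_mat[OF _ _ _ B]) (use B in \<open>auto intro!: cong_four_block_mat eq_matI simp: scalar_prod_def ones_mat_def\<close>)
  have "det ?P * det ?Q = det (?P * ?Q)" by (rule det_mult[OF P Q, symmetric])
  also have "\<dots> = det (?c 1) * det (B + ones_mat k)"
    unfolding PQ by (rule det_four_block_mat_upper_right_zero) (use B in \<open>auto simp: ones_mat_def\<close>)
  also have "det ?Q = det (?c 1) * det (1\<^sub>m k :: int mat)"
    by (rule det_four_block_mat_lower_left_zero) auto
  finally have 1: "det ?P = det (B + ones_mat k)" by (simp add: det_single)
  \<comment> \<open>Here the first column becomes \<open>b\<close> times itself minus the sum of the
    others: the corner is \<open>b + int k\<close>, and below it stands \<open>b\<close> minus a row
    sum, which is 0. The determinant of \<open>?S\<close> is \<open>b\<close>, the factor on the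
    left of the claim.\<close>
  have PS: "?P * ?S = four_block_mat (?c (b + int k)) (?u (-1)) (0\<^sub>m k 1) B"
    by (subst mult_four_block_mat[OF _ _ _ B])
      (use B rows in \<open>auto intro!: cong_four_block_mat eq_matI simp: scalar_prod_def lessThan_atLeast0 sum_negf\<close>)
  have "det ?P * det ?S = det (?P * ?S)" by (rule det_mult[OF P S, symmetric])
  also have "\<dots> = det (?c (b + int k)) * det B"
    unfolding PS by (rule det_four_block_mat_lower_left_zero) (use B in auto)
  also have "det ?S = det (?c b) * det (1\<^sub>m k :: int mat)"
    by (rule det_four_block_mat_upper_right_zero) auto
  finally show ?thesis using 1 by (simp add: det_single mult.commute)
qed

text \<open>Evaluation at \<open>- x\<close> gives the determinant of the negated matrix; its sign,
  a power of -1, disappears in the absolute value.\<close>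

lemma abs_poly_char_poly_uminus:
  fixes L :: "int mat"
  assumes L: "L \<in> carrier_mat k k"
  shows "\<bar>poly (char_poly L) (- x)\<bar> = \<bar>det (x \<cdot>\<^sub>m 1\<^sub>m k + L)\<bar>"
proof -
  have "poly (char_poly L) (- x) = det ((-1) \<cdot>\<^sub>m (x \<cdot>\<^sub>m 1\<^sub>m k + L))"
    unfolding char_poly_def
    by (rule poly_det_cong[of _ k]) (use L in \<open>auto simp: char_poly_matrix_def\<close>)
  then show ?thesis using L by (simp add: det_smult abs_mult power_abs)
qed

section \<open>Laplacians of cones\<close>

text \<open>This is \<open>D - A^t\<close> acting on coefficient functions: chains are pushed along
  outgoing arcs, so the coefficient at \<open>v\<close> collects the values at the tails of the
  incoming arcs.\<close>

definition graph_laplace :: "('a, 'b) pre_digraph \<Rightarrow> ('a \<Rightarrow> int) \<Rightarrow> 'a \<Rightarrow> int" where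
  "graph_laplace H f v = int (out_degree H v) * f v - (\<Sum>e\<in>in_arcs H v. f (tail H e))"

lemma graph_laplace_diff:
  "graph_laplace H (\<lambda>v. f v - g v) w = graph_laplace H f w - graph_laplace H g w"
  by (simp add: graph_laplace_def sum_subtractf algebra_simps)

lemma graph_laplace_cong:
  assumes "fin_digraph H" "w \<in> verts H" "\<And>v. v \<in> verts H \<Longrightarrow> f v = g v"
  shows "graph_laplace H f w = graph_laplace H g w"
proof -
  interpret fin_digraph H by fact
  show ?thesis using assms(2,3) by (auto simp: graph_laplace_def intro!: sum.cong)
qed

text \<open>By linearity a single vertex \<open>v\<close> suffices, and there both sides count the
  arcs from \<open>v\<close> to \<open>w\<close>.\<close>

lemma lookup_laplacian:
  assumes "fin_digraph H"
  shows "Poly_Mapping.lookup (laplacian H c) w = graph_laplace H (Poly_Mapping.lookup c) w"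
proof -
  interpret fin_digraph H by fact
  show ?thesis
  proof (induction c rule: frag_induction[OF subset_UNIV])
    case 1
    then show ?case by (simp add: laplacian_def graph_laplace_def)
  next
    case (2 v)
    have "(\<Sum>e\<in>out_arcs H v. if w = head H e then 1 else 0) = (\<Sum>e\<in>{e \<in> arcs H. tail H e = v \<and> head H e = w}. (1::int))"
      by (subst sum.inter_filter[symmetric]) (auto intro!: arg_cong[where f = card])
    moreover have "(\<Sum>e\<in>in_arcs H w. if tail H e = v then 1 else 0) = (\<Sum>e\<in>{e \<in> arcs H. tail H e = v \<and> head H e = w}. (1::int))"
      by (subst sum.inter_filter[symmetric]) (auto intro!: arg_cong[where f = card])
    ultimately show ?case
      by (auto simp: laplacian_def graph_laplace_def lookup_minus lookup_sum lookup_single when_def)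
  next
    case (3 a b)
    then show ?case
      by (simp add: laplacian_def frag_extend_diff lookup_minus graph_laplace_diff)
  qed
qed

text \<open>Each arc contributes the value at its tail twice with opposite signs: in the outdegree
  term of its tail and in the sum at its head. So images of the Laplacian have degree 0.\<close>

lemma sum_graph_laplace:
  assumes "fin_digraph H"
  shows "(\<Sum>w\<in>verts H. graph_laplace H f w) = 0"
proof -
  interpret fin_digraph H by fact
  have "(\<Sum>w\<in>verts H. \<Sum>e\<in>in_arcs H w. f (tail H e)) = (\<Sum>e\<in>arcs H. f (tail H e))"
    unfolding in_arcs_def by (rule sum.group) auto
  moreover have "(\<Sum>w\<in>verts H. \<Sum>e\<in>out_arcs H w. f (tail H e)) = (\<Sum>e\<in>arcs H. f (tail H e))"
    unfolding out_arcs_def by (rule sum.group) auto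
  moreover have "(\<Sum>e\<in>out_arcs H w. f (tail H e)) = int (out_degree H w) * f w" for w
    by (simp add: out_degree_def)
  ultimately show ?thesis by (simp only: graph_laplace_def sum_subtractf)
qed

lemma keys_laplacian:
  assumes "fin_digraph H"
  shows "Poly_Mapping.keys (laplacian H c) \<subseteq> verts H"
proof
  interpret fin_digraph H by fact
  fix w assume "w \<in> Poly_Mapping.keys (laplacian H c)"
  then have ne: "graph_laplace H (Poly_Mapping.lookup c) w \<noteq> 0"
    by (simp add: in_keys_iff lookup_laplacian[OF assms])
  show "w \<in> verts H"
  proof (rule ccontr)
    assume w: "w \<notin> verts H"
    then have "in_arcs H w = {}" "out_arcs H w = {}"
      by (auto simp: in_arcs_def out_arcs_def)
    with ne show False by (simp add: graph_laplace_def out_degree_def)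
  qed
qed

lemma degree_map_eq:
  assumes "finite V" "Poly_Mapping.keys c \<subseteq> V"
  shows "degree_map c = (\<Sum>v\<in>V. Poly_Mapping.lookup c v)"
  unfolding degree_map_def using assms
  by (intro sum.mono_neutral_left) (auto simp: in_keys_iff)

section \<open>Arcs and Laplacian of the cone\<close>

lemma verts_iterated_cone: "verts (iterated_cone n G) = verts G <+> {..<n}"
  by (simp add: iterated_cone_def graph_join_def complete_graph_def)

lemma fin_digraph_iterated_cone:
  assumes "fin_digraph G"
  shows "fin_digraph (iterated_cone n G)"
proof -
  interpret fin_digraph G by fact
  have "finite {(i, j). i < n \<and> j < n \<and> i \<noteq> j}"
    by (rule finite_subset[of _ "{..<n} \<times> {..<n}"]) auto
  then show ?thesis
    by unfold_locales (auto simp: iterated_cone_def graph_join_def complete_graph_def)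
qed

lemma in_arcs_iterated_cone_Inl:
  assumes "v \<in> verts G"
  shows "in_arcs (iterated_cone n G) (Inl v)
    = (\<lambda>e. Inl (Inl e)) ` in_arcs G v \<union> (\<lambda>i. Inr (Inr (i, v))) ` {..<n}"
  using assms
  by (auto simp: in_arcs_def iterated_cone_def graph_join_def complete_graph_def Plus_def)

lemma out_arcs_iterated_cone_Inl:
  assumes "v \<in> verts G"
  shows "out_arcs (iterated_cone n G) (Inl v)
    = (\<lambda>e. Inl (Inl e)) ` out_arcs G v \<union> (\<lambda>i. Inr (Inl (v, i))) ` {..<n}"
  using assms
  by (auto simp: out_arcs_def iterated_cone_def graph_join_def complete_graph_def Plus_def)

lemma in_arcs_iterated_cone_Inr:
  assumes "i < n"
  shows "in_arcs (iterated_cone n G) (Inr i)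
    = (\<lambda>j. Inl (Inr (j, i))) ` ({..<n} - {i}) \<union> (\<lambda>v. Inr (Inl (v, i))) ` verts G"
  using assms
  by (auto simp: in_arcs_def iterated_cone_def graph_join_def complete_graph_def Plus_def)

lemma out_arcs_iterated_cone_Inr:
  assumes "i < n"
  shows "out_arcs (iterated_cone n G) (Inr i)
    = (\<lambda>j. Inl (Inr (i, j))) ` ({..<n} - {i}) \<union> (\<lambda>v. Inr (Inr (i, v))) ` verts G"
  using assms
  by (auto simp: out_arcs_def iterated_cone_def graph_join_def complete_graph_def Plus_def)

lemma tail_iterated_cone:
  "tail (iterated_cone n G) (Inl (Inl e)) = Inl (tail G e)"
  "tail (iterated_cone n G) (Inl (Inr (i, j))) = Inr i"
  "tail (iterated_cone n G) (Inr (Inl (v, i))) = Inl v"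
  "tail (iterated_cone n G) (Inr (Inr (i, v))) = Inr i"
  by (simp_all add: iterated_cone_def graph_join_def complete_graph_def)

lemma graph_laplace_iterated_cone_Inl:
  assumes "fin_digraph G" "v \<in> verts G"
  shows "graph_laplace (iterated_cone n G) f (Inl v)
    = graph_laplace G (\<lambda>v. f (Inl v)) v + int n * f (Inl v) - (\<Sum>i<n. f (Inr i))"
proof -
  interpret fin_digraph G by fact
  have "out_degree (iterated_cone n G) (Inl v) = out_degree G v + n"
    unfolding out_degree_def out_arcs_iterated_cone_Inl[OF assms(2)]
    by (subst card_Un_disjoint) (auto simp: card_image inj_on_def)
  moreover have "(\<Sum>e\<in>in_arcs (iterated_cone n G) (Inl v). f (tail (iterated_cone n G) e))
    = (\<Sum>e\<in>in_arcs G v. f (Inl (tail G e))) + (\<Sum>i<n. f (Inr i))"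
    unfolding in_arcs_iterated_cone_Inl[OF assms(2)]
    by (subst sum.union_disjoint) (auto simp: sum.reindex inj_on_def tail_iterated_cone)
  ultimately show ?thesis by (simp add: graph_laplace_def algebra_simps)
qed

text \<open>An apex is joined to the other \<open>n - 1\<close> apexes and to \<open>G\<close>.
  Including its own value in the subtracted sum raises the coefficient to
  \<open>n + card (verts G)\<close> and makes that sum the same for all apexes, so that it cancels
  in differences.\<close>

lemma graph_laplace_iterated_cone_Inr:
  assumes "fin_digraph G" "i < n"
  shows "graph_laplace (iterated_cone n G) f (Inr i)
    = int (n + card (verts G)) * f (Inr i) - ((\<Sum>v\<in>verts G. f (Inl v)) + (\<Sum>j<n. f (Inr j)))"
proof -
  interpret fin_digraph G by fact
  have "out_degree (iterated_cone n G) (Inr i) = n - 1 + card (verts G)"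
    unfolding out_degree_def out_arcs_iterated_cone_Inr[OF assms(2)]
    using assms(2) by (subst card_Un_disjoint) (auto simp: card_image inj_on_def)
  moreover have "(\<Sum>e\<in>in_arcs (iterated_cone n G) (Inr i). f (tail (iterated_cone n G) e))
    = (\<Sum>j\<in>{..<n} - {i}. f (Inr j)) + (\<Sum>v\<in>verts G. f (Inl v))"
    unfolding in_arcs_iterated_cone_Inr[OF assms(2)]
    by (subst sum.union_disjoint) (auto simp: sum.reindex inj_on_def tail_iterated_cone)
  moreover have "(\<Sum>j<n. f (Inr j)) = f (Inr i) + (\<Sum>j\<in>{..<n} - {i}. f (Inr j))"
    using assms(2) by (intro sum.remove) auto
  ultimately show ?thesis using assms(2) by (simp add: graph_laplace_def algebra_simps)
qed

section \<open>The matrix of the cokernel\<close>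

locale eulerian_cone = fin_digraph G for G :: "('a, 'b) pre_digraph" +
  fixes vs :: "'a list" and n k :: nat
  assumes eulerian: "eulerian G"
    and nonempty: "verts G \<noteq> {}"
    and card_verts: "card (verts G) = k"
    and distinct: "distinct vs"
    and set_vs: "set vs = verts G"
    and n_ge_2: "n \<ge> 2"
begin

abbreviation C where "C \<equiv> iterated_cone n G"

definition M :: "int mat" where
  "M = int n \<cdot>\<^sub>m 1\<^sub>m k + laplacian_mat G vs + ones_mat k"

definition vec_of :: "('a \<Rightarrow> int) \<Rightarrow> int vec" where
  "vec_of f = vec k (\<lambda>i. f (vs ! i))"

lemma length_vs: "length vs = k"
  using distinct_card[OF distinct] by (simp add: set_vs card_verts)

lemma nth_vs: "i < k \<Longrightarrow> vs ! i \<in> verts G"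
  using set_vs length_vs nth_mem by blast

lemma L_carrier: "laplacian_mat G vs \<in> carrier_mat k k"
  by (intro carrier_matI) (simp_all add: laplacian_mat_def outdegree_mat_def adjacency_mat_def length_vs)

lemma M_carrier: "M \<in> carrier_mat k k"
  using L_carrier by (simp add: M_def ones_mat_def)

lemma vec_of_carrier [simp]: "vec_of f \<in> carrier_vec k"
  by (simp add: vec_of_def)

lemma vec_of_eq_iff: "vec_of f = vec_of g \<longleftrightarrow> (\<forall>v\<in>verts G. f v = g v)"
  by (auto simp: vec_of_def vec_eq_iff nth_vs) (metis in_set_conv_nth set_vs length_vs)

lemma vec_of_diff: "vec_of f - vec_of g = vec_of (\<lambda>v. f v - g v)"
  by (auto simp: vec_of_def)

lemma vec_of_add: "vec_of f + vec_of g = vec_of (\<lambda>v. f v + g v)"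
  by (auto simp: vec_of_def)

lemma vec_of_surj:
  assumes "u \<in> carrier_vec k"
  obtains f where "u = vec_of f"
proof
  have "inj_on ((!) vs) {..<k}"
    using distinct by (simp add: inj_on_nth length_vs)
  then show "u = vec_of (\<lambda>v. u $ inv_into {..<k} ((!) vs) v)"
    using assms by (intro eq_vecI) (auto simp: vec_of_def inv_into_f_f)
qed

lemma sum_vs: "(\<Sum>j<k. g (vs ! j)) = (\<Sum>v\<in>verts G. g v)"
  using sum.reindex_bij_betw[OF bij_betw_nth[OF distinct refl set_vs[symmetric]]] by (simp add: length_vs)

text \<open>A matrix row groups the arcs into a vertex by their tails; summing over the arcs one by
  one gives \<open>graph_laplace\<close>.\<close>

lemma L_mult_vec_of: "laplacian_mat G vs *\<^sub>v vec_of f = vec_of (graph_laplace G f)"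
proof (rule eq_vecI)
  fix i assume "i < dim_vec (vec_of (graph_laplace G f))"
  then have i: "i < k" by (simp add: vec_of_def)
  let ?w = "vs ! i"
  have "(laplacian_mat G vs *\<^sub>v vec_of f) $ i
      = (\<Sum>j<k. (if i = j then int (out_degree G ?w) else 0) * f (vs ! j)
         - int (card {e \<in> arcs G. tail G e = vs ! j \<and> head G e = ?w}) * f (vs ! j))"
    using i by (simp add: laplacian_mat_def outdegree_mat_def adjacency_mat_def length_vs vec_of_def
        scalar_prod_def lessThan_atLeast0 left_diff_distrib)
  also have "\<dots> = int (out_degree G ?w) * f ?w
      - (\<Sum>v\<in>verts G. int (card {e \<in> arcs G. tail G e = v \<and> head G e = ?w}) * f v)"
    using i sum_vs[of "\<lambda>v. int (card {e \<in> arcs G. tail G e = v \<and> head G e = ?w}) * f v"]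
    by (simp add: sum_subtractf if_distrib[of "\<lambda>x. x * _"] sum.delta' cong: if_cong)
  also have "(\<Sum>v\<in>verts G. int (card {e \<in> arcs G. tail G e = v \<and> head G e = ?w}) * f v)
      = (\<Sum>v\<in>verts G. \<Sum>e\<in>{e \<in> in_arcs G ?w. tail G e = v}. f (tail G e))"
  proof (rule sum.cong[OF refl])
    fix v
    have "{e \<in> arcs G. tail G e = v \<and> head G e = ?w} = {e \<in> in_arcs G ?w. tail G e = v}" by auto
    then show "int (card {e \<in> arcs G. tail G e = v \<and> head G e = ?w}) * f v
        = (\<Sum>e\<in>{e \<in> in_arcs G ?w. tail G e = v}. f (tail G e))" by simp
  qed
  also have "\<dots> = (\<Sum>e\<in>in_arcs G ?w. f (tail G e))"
    by (rule sum.group) auto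
  finally show "(laplacian_mat G vs *\<^sub>v vec_of f) $ i = vec_of (graph_laplace G f) $ i"
    using i by (simp add: vec_of_def graph_laplace_def)
qed (use L_carrier in \<open>auto simp: vec_of_def\<close>)

lemma M_mult_vec_of:
  "M *\<^sub>v vec_of f = vec_of (\<lambda>v. graph_laplace G f v + int n * f v + (\<Sum>w\<in>verts G. f w))"
proof -
  have "M *\<^sub>v vec_of f = (int n \<cdot>\<^sub>m 1\<^sub>m k) *\<^sub>v vec_of f + laplacian_mat G vs *\<^sub>v vec_of f + ones_mat k *\<^sub>v vec_of f"
    unfolding M_def using L_carrier
    by (simp add: add_mult_distrib_mat_vec[of _ k k] ones_mat_def)
  also have "(int n \<cdot>\<^sub>m 1\<^sub>m k) *\<^sub>v vec_of f = vec_of (\<lambda>v. int n * f v)"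
    by (intro eq_vecI) (simp_all add: vec_of_def scalar_prod_def if_distrib[of "\<lambda>x. _ * x"]
        if_distrib[of "\<lambda>x. x * _"] sum.delta' cong: if_cong)
  also have "ones_mat k *\<^sub>v vec_of f = vec_of (\<lambda>_. \<Sum>w\<in>verts G. f w)"
    by (intro eq_vecI) (auto simp: ones_mat_def vec_of_def scalar_prod_def lessThan_atLeast0[symmetric] sum_vs)
  finally show ?thesis by (simp add: L_mult_vec_of vec_of_add add.commute)
qed

text \<open>Equality of indegree and outdegree spreads the diagonal term over the incoming arcs.
  This form shows that constants are annihilated and gives the signs at extrema.\<close>

lemma graph_laplace_eulerian:
  assumes "v \<in> verts G"
  shows "graph_laplace G f v = (\<Sum>e\<in>in_arcs G v. f v - f (tail G e))"
  using assms eulerian by (simp add: graph_laplace_def sum_subtractf eulerian_def in_degree_def[symmetric])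

lemma graph_laplace_const: "v \<in> verts G \<Longrightarrow> graph_laplace G (\<lambda>_. a) v = 0"
  by (simp add: graph_laplace_eulerian)

lemma M_mult_vec_of_const: "M *\<^sub>v vec_of (\<lambda>_. a) = vec_of (\<lambda>_. int (n + k) * a)"
  unfolding M_mult_vec_of vec_of_eq_iff
  by (simp add: graph_laplace_const card_verts algebra_simps)

text \<open>Maximum principle: at a maximum of \<open>f\<close> the Laplacian is nonnegative, at a minimum nonpositive.\<close>
lemma M_mult_eq_const:
  assumes "M *\<^sub>v vec_of f = vec_of (\<lambda>_. m)"
  shows "\<exists>a. (\<forall>v\<in>verts G. f v = a) \<and> m = int (n + k) * a"
proof -
  let ?S = "\<Sum>w\<in>verts G. f w"
  have eq: "graph_laplace G f v + int n * f v + ?S = m" if "v \<in> verts G" for v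
    using assms that unfolding M_mult_vec_of vec_of_eq_iff by blast
  obtain x where x: "x \<in> verts G" "\<And>v. v \<in> verts G \<Longrightarrow> f v \<le> f x"
    using finite_verts nonempty obtains_MAX[of "verts G" f] by (metis Max_ge finite_imageI imageI)
  obtain y where y: "y \<in> verts G" "\<And>v. v \<in> verts G \<Longrightarrow> f y \<le> f v"
    using finite_verts nonempty obtains_MIN[of "verts G" f] by (metis Min_le finite_imageI imageI)
  have "graph_laplace G f x \<ge> 0" "graph_laplace G f y \<le> 0"
    using x y by (auto simp: graph_laplace_eulerian intro!: sum_nonneg sum_nonpos)
  \<comment> \<open>The total \<open>?S\<close> and the value \<open>m\<close> occur in both
    equations and cancel.\<close>
  then have "int n * f x \<le> int n * f y" using eq[OF x(1)] eq[OF y(1)] by linarith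
  then have "f x \<le> f y" using n_ge_2 by simp
  then have const: "f v = f x" if "v \<in> verts G" for v
    using x(2)[OF that] y(2)[OF that] by linarith
  then have "vec_of f = vec_of (\<lambda>_. f x)" by (simp add: vec_of_eq_iff)
  with assms have "m = int (n + k) * f x"
    using nonempty by (auto simp: M_mult_vec_of_const vec_of_eq_iff)
  with const show ?thesis by blast
qed

text \<open>A kernel vector is the case \<open>m = 0\<close> of \<open>M_mult_eq_const\<close>: it
  is constant, and its value is 0.\<close>

lemma det_M_nonzero: "det M \<noteq> 0"
proof
  assume "det M = 0"
  then obtain u where u: "u \<in> carrier_vec k" "u \<noteq> 0\<^sub>v k" "M *\<^sub>v u = 0\<^sub>v k"
    using det_0_iff_vec_prod_zero[OF M_carrier] by blast
  obtain f where f: "u = vec_of f" using vec_of_surj[OF u(1)] .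
  have zero: "0\<^sub>v k = vec_of (\<lambda>_. 0)" by (auto simp: vec_of_def)
  from u(3) obtain a where "\<forall>v\<in>verts G. f v = a" "0 = int (n + k) * a"
    using M_mult_eq_const[of f 0] unfolding f zero by blast
  then have "u = 0\<^sub>v k" using n_ge_2 unfolding f zero vec_of_eq_iff by simp
  with u show False by simp
qed

lemma vec_of_const_in_image_iff: "vec_of (\<lambda>_. m) \<in> mat_image M \<longleftrightarrow> int (n + k) dvd m"
proof
  assume "vec_of (\<lambda>_. m) \<in> mat_image M"
  then obtain u where u: "u \<in> carrier_vec k" "vec_of (\<lambda>_. m) = M *\<^sub>v u"
    using M_carrier by (auto simp: mat_image_def)
  obtain f where "u = vec_of f" using vec_of_surj[OF u(1)] .
  with u(2) show "int (n + k) dvd m" using M_mult_eq_const[of f m] by auto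
next
  assume "int (n + k) dvd m"
  then obtain a where "m = int (n + k) * a" by auto
  then have "vec_of (\<lambda>_. m) = M *\<^sub>v vec_of (\<lambda>_. a)" by (simp add: M_mult_vec_of_const)
  then show "vec_of (\<lambda>_. m) \<in> mat_image M"
    using M_carrier by (auto simp: mat_image_def)
qed

text \<open>The Laplacian annihilates constants, so every row of \<open>?B\<close> sums to
  \<open>int n\<close>, and \<open>det_add_ones_mat\<close> applies with this row sum.\<close>

lemma det_M: "int n * \<bar>det M\<bar> = int (n + k) * \<bar>poly (char_poly (laplacian_mat G vs)) (- int n)\<bar>"
proof -
  let ?B = "int n \<cdot>\<^sub>m 1\<^sub>m k + laplacian_mat G vs"
  have B: "?B \<in> carrier_mat k k" using L_carrier by simp
  have "(\<Sum>j<k. ?B $$ (i, j)) = int n" if i: "i < k" for i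
  proof -
    have "(\<Sum>j<k. laplacian_mat G vs $$ (i, j)) = (laplacian_mat G vs *\<^sub>v vec_of (\<lambda>_. 1)) $ i"
      using i L_carrier by (simp add: vec_of_def scalar_prod_def lessThan_atLeast0)
    also have "\<dots> = 0"
      unfolding L_mult_vec_of using i nth_vs by (simp add: vec_of_def graph_laplace_const)
    finally show ?thesis
      using i L_carrier by (simp add: sum.distrib if_distrib[of "\<lambda>x. _ * x"] sum.delta' cong: if_cong)
  qed
  from det_add_ones_mat[OF B this] have "int n * det M = (int n + int k) * det ?B"
    by (simp add: M_def)
  then have "int n * \<bar>det M\<bar> = (int n + int k) * \<bar>det ?B\<bar>"
    by (metis abs_mult abs_of_nat of_nat_add)
  then show ?thesis using abs_poly_char_poly_uminus[OF L_carrier] by simp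
qed

end

section \<open>The critical group of the cone\<close>

context eulerian_cone
begin

abbreviation chain_group where "chain_group \<equiv> free_Abelian_group (verts C)"

abbreviation degree0_group where
  "degree0_group \<equiv> chain_group\<lparr>carrier := kernel chain_group integer_group degree_map\<rparr>"

abbreviation torsion_group where
  "torsion_group \<equiv> product_group {..<n - 2} (\<lambda>_. integer_mod_group (n + k))"

text \<open>\<open>Inr 0\<close> is the reference vertex, so component \<open>i\<close> belongs to
  the apex \<open>Inr (Suc i)\<close>. The apex \<open>Inr (n - 1)\<close> is left out because the
  degree condition determines its coefficient.\<close>

definition cone_hom :: "('a + nat \<Rightarrow>\<^sub>0 int) \<Rightarrow> (nat \<Rightarrow> int) \<times> int vec set" where
  "cone_hom c = (\<lambda>i\<in>{..<n - 2}. (Poly_Mapping.lookup c (Inr (Suc i)) - Poly_Mapping.lookup c (Inr 0)) mod int (n + k),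
     cok_class M (vec_of (\<lambda>v. Poly_Mapping.lookup c (Inl v) - Poly_Mapping.lookup c (Inr 0))))"

lemma fin_cone: "fin_digraph C"
  by (rule fin_digraph_iterated_cone) unfold_locales

lemma finite_verts_cone: "finite (verts C)"
  by (rule fin_digraph.finite_verts[OF fin_cone])

lemma sum_verts_cone: "(\<Sum>x\<in>verts C. g x) = (\<Sum>v\<in>verts G. g (Inl v)) + (\<Sum>i<n. g (Inr i))"
  unfolding verts_iterated_cone by (subst sum.Plus) (auto simp: o_def)

text \<open>The last apex is a case of its own: equations there are not computed but recovered from
  the total.\<close>

lemma verts_cone_cases:
  assumes "x \<in> verts C"
  obtains (base) v where "v \<in> verts G" "x = Inl v"
    | (apex) i where "i < n - 1" "x = Inr i"
    | (last) "x = Inr (n - 1)"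
proof (cases x)
  case (Inl v)
  then show ?thesis using assms base by (auto simp: verts_iterated_cone)
next
  case (Inr i)
  then have "i < n - 1 \<or> i = n - 1" using assms by (auto simp: verts_iterated_cone)
  then show ?thesis using Inr apex last by blast
qed

lemma degree_map_hom: "degree_map \<in> hom chain_group integer_group"
proof (rule homI)
  fix x y assume "x \<in> carrier chain_group" "y \<in> carrier chain_group"
  then have "Poly_Mapping.keys x \<subseteq> verts C" "Poly_Mapping.keys y \<subseteq> verts C" by auto
  moreover from this have "Poly_Mapping.keys (x + y) \<subseteq> verts C"
    using Poly_Mapping.keys_add[of x y] by blast
  ultimately show "degree_map (x \<otimes>\<^bsub>chain_group\<^esub> y) = degree_map x \<otimes>\<^bsub>integer_group\<^esub> degree_map y"
    by (simp add: degree_map_eq[OF finite_verts_cone] lookup_add sum.distrib)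
qed simp

lemma group_degree0: "group degree0_group"
proof -
  interpret group_hom chain_group integer_group degree_map
    by (intro group_hom.intro group_hom_axioms.intro degree_map_hom) auto
  show ?thesis using subgroup_kernel by (rule subgroup.subgroup_is_group) simp
qed

lemma degree0_iff: "c \<in> kernel chain_group integer_group degree_map \<longleftrightarrow>
    Poly_Mapping.keys c \<subseteq> verts C \<and> (\<Sum>x\<in>verts C. Poly_Mapping.lookup c x) = 0"
  by (auto simp: kernel_def degree_map_eq[OF finite_verts_cone])

lemma group_target: "group (torsion_group \<times>\<times> cok M)"
  by (intro DirProd_group group_cok[OF M_carrier] product_group) auto

lemma mod_mem_integer_mod_group: "x mod int (n + k) \<in> carrier (integer_mod_group (n + k))"
  using n_ge_2 by (simp add: carrier_integer_mod_group)

lemma cone_hom_hom: "cone_hom \<in> hom degree0_group (torsion_group \<times>\<times> cok M)"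
proof (rule homI)
  fix c assume "c \<in> carrier degree0_group"
  show "cone_hom c \<in> carrier (torsion_group \<times>\<times> cok M)"
    using mod_mem_integer_mod_group by (auto simp: cone_hom_def carrier_cok[OF M_carrier])
next
  fix b c
  show "cone_hom (b \<otimes>\<^bsub>degree0_group\<^esub> c) = cone_hom b \<otimes>\<^bsub>torsion_group \<times>\<times> cok M\<^esub> cone_hom c"
    by (auto simp: cone_hom_def mult_cok[OF M_carrier] vec_of_add lookup_add mod_add_eq algebra_simps
        intro!: restrict_ext arg_cong[where f = "cok_class M"] arg_cong[where f = vec_of])
qed

text \<open>The last apex absorbs whatever brings the total to \<open>s\<close>. The choice
  \<open>s = 0\<close> serves surjectivity; a nonzero total is needed when preimages under the
  Laplacian are built.\<close>

lemma exists_chain_with_sum: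
  fixes f :: "'a \<Rightarrow> int" and d :: "nat \<Rightarrow> int" and s :: int
  obtains c where "Poly_Mapping.keys c \<subseteq> verts C"
    and "\<And>v. v \<in> verts G \<Longrightarrow> Poly_Mapping.lookup c (Inl v) = f v"
    and "Poly_Mapping.lookup c (Inr 0) = 0"
    and "\<And>i. i < n - 2 \<Longrightarrow> Poly_Mapping.lookup c (Inr (Suc i)) = d i"
    and "(\<Sum>x\<in>verts C. Poly_Mapping.lookup c x) = s"
proof -
  define t where "t = s - (\<Sum>v\<in>verts G. f v) - (\<Sum>i<n - 2. d i)"
  \<comment> \<open>The index \<open>i = n - 2\<close> under \<open>Suc\<close> is the last apex
    \<open>n - 1\<close>, which differs from apex 0 because \<open>n \<ge> 2\<close>.\<close>
  define g where "g = (\<lambda>x. case x of Inl v \<Rightarrow> if v \<in> verts G then f v else 0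
     | Inr 0 \<Rightarrow> 0 | Inr (Suc i) \<Rightarrow> if i < n - 2 then d i else if i = n - 2 then t else 0)"
  have "x \<in> verts C" if "g x \<noteq> 0" for x
    using n_ge_2 that
    by (cases x) (auto simp: g_def verts_iterated_cone split: nat.splits if_splits)
  then have "{x. g x \<noteq> 0} \<subseteq> verts C" by auto
  then have lookup: "Poly_Mapping.lookup (Abs_poly_mapping g) = g"
    and keys: "Poly_Mapping.keys (Abs_poly_mapping g) \<subseteq> verts C"
    using finite_subset[OF _ finite_verts_cone] by (auto simp: Abs_poly_mapping_inverse keys.rep_eq)
  have n: "n = Suc (Suc (n - 2))" using n_ge_2 by simp
  have "(\<Sum>i<n. g (Inr i)) = (\<Sum>i<n - 2. d i) + t"
    by (subst n, subst sum.lessThan_Suc_shift) (simp add: g_def)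
  then have "(\<Sum>x\<in>verts C. g x) = s" by (simp add: sum_verts_cone g_def t_def)
  then show ?thesis
    using keys by (intro that[of "Abs_poly_mapping g"]) (simp_all add: lookup, simp_all add: g_def)
qed

lemma cone_hom_surj: "cone_hom ` carrier degree0_group = carrier (torsion_group \<times>\<times> cok M)"
proof
  show "cone_hom ` carrier degree0_group \<subseteq> carrier (torsion_group \<times>\<times> cok M)"
    using hom_in_carrier[OF cone_hom_hom] by blast
  show "carrier (torsion_group \<times>\<times> cok M) \<subseteq> cone_hom ` carrier degree0_group"
  proof
    fix z assume "z \<in> carrier (torsion_group \<times>\<times> cok M)"
    then obtain d u where z: "z = (d, cok_class M u)" "u \<in> carrier_vec k"
      "d \<in> (\<Pi>\<^sub>E i\<in>{..<n - 2}. carrier (integer_mod_group (n + k)))"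
      by (auto simp: carrier_cok[OF M_carrier])
    obtain f where f: "u = vec_of f" using vec_of_surj[OF z(2)] .
    obtain c where keys: "Poly_Mapping.keys c \<subseteq> verts C"
      and c: "\<And>v. v \<in> verts G \<Longrightarrow> Poly_Mapping.lookup c (Inl v) = f v"
        "Poly_Mapping.lookup c (Inr 0) = 0"
        "\<And>i. i < n - 2 \<Longrightarrow> Poly_Mapping.lookup c (Inr (Suc i)) = d i"
      and sum: "(\<Sum>x\<in>verts C. Poly_Mapping.lookup c x) = 0"
      using exists_chain_with_sum[of f d 0] by blast
    have "c \<in> carrier degree0_group" using keys sum by (simp add: degree0_iff)
    moreover have "cone_hom c = z"
    proof -
      \<comment> \<open>Elements of \<open>integer_mod_group\<close> are reduced residues, so they
        serve as their own integer lifts.\<close>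
      have "d i mod int (n + k) = d i" if "i < n - 2" for i
        using z(3) that n_ge_2 by (auto simp: carrier_integer_mod_group PiE_iff)
      then have "(\<lambda>i\<in>{..<n - 2}. d i mod int (n + k)) = d"
        using z(3) by (intro extensionalityI[of _ "{..<n - 2}"]) (auto simp: PiE_def)
      moreover have "(\<lambda>i\<in>{..<n - 2}. (Poly_Mapping.lookup c (Inr (Suc i)) - Poly_Mapping.lookup c (Inr 0)) mod int (n + k))
          = (\<lambda>i\<in>{..<n - 2}. d i mod int (n + k))"
        by (rule restrict_ext) (simp add: c)
      moreover have "vec_of (\<lambda>v. Poly_Mapping.lookup c (Inl v) - Poly_Mapping.lookup c (Inr 0)) = u"
        by (simp add: f vec_of_eq_iff c)
      ultimately show ?thesis by (simp add: cone_hom_def z)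
    qed
    ultimately show "z \<in> cone_hom ` carrier degree0_group" by blast
  qed
qed

lemma eq_if_sum_verts_eq:
  assumes "\<And>x. x \<in> verts C \<Longrightarrow> x \<noteq> y \<Longrightarrow> f x = g x" "y \<in> verts C"
    "(\<Sum>x\<in>verts C. f x) = (\<Sum>x\<in>verts C. g x)"
  shows "f y = (g y :: int)"
  using assms sum.remove[OF finite_verts_cone assms(2), of f] sum.remove[OF finite_verts_cone assms(2), of g]
    sum.cong[of "verts C - {y}" "verts C - {y}" f g] by simp

text \<open>Constants are killed by the Laplacian of the cone, so a preimage \<open>b\<close> of
  \<open>c\<close> may be sought with value 0 at \<open>Inr 0\<close>. Its values at the middle
  apexes are the quotients by \<open>n + k\<close>, its values on \<open>G\<close> come from a
  preimage under \<open>M\<close>, and its total is prescribed by the equation at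
  \<open>Inr 0\<close>.\<close>

lemma kernel_cone_hom:
  "kernel degree0_group (torsion_group \<times>\<times> cok M) cone_hom = laplacian C ` carrier chain_group"
proof
  let ?N = "int (n + k)"
  note lap = lookup_laplacian[OF fin_cone]
  note lap_Inl = graph_laplace_iterated_cone_Inl[OF fin_digraph_axioms]
  note lap_Inr = graph_laplace_iterated_cone_Inr[OF fin_digraph_axioms]
  show "laplacian C ` carrier chain_group \<subseteq> kernel degree0_group (torsion_group \<times>\<times> cok M) cone_hom"
  proof
    fix c assume "c \<in> laplacian C ` carrier chain_group"
    then obtain b where c: "c = laplacian C b" by blast
    let ?b = "Poly_Mapping.lookup b"
    have deg: "c \<in> carrier degree0_group"
      using keys_laplacian[OF fin_cone, of b] sum_graph_laplace[OF fin_cone, of ?b]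
      by (simp add: degree0_iff c lap)
    have "(Poly_Mapping.lookup c (Inr (Suc i)) - Poly_Mapping.lookup c (Inr 0)) mod ?N = 0" if "i < n - 2" for i
    proof -
      have "Suc i < n" "0 < n" using that by auto
      then have "Poly_Mapping.lookup c (Inr (Suc i)) - Poly_Mapping.lookup c (Inr 0)
          = ?N * (?b (Inr (Suc i)) - ?b (Inr 0))"
        by (simp add: c lap lap_Inr card_verts right_diff_distrib)
      then show ?thesis by simp
    qed
    \<comment> \<open>The sum over the apexes cancels in the difference. The leftover
      \<open>n + k\<close> times the value at \<open>Inr 0\<close> is \<open>M\<close> applied to
      that constant.\<close>
    moreover have "vec_of (\<lambda>v. Poly_Mapping.lookup c (Inl v) - Poly_Mapping.lookup c (Inr 0))
        = M *\<^sub>v vec_of (\<lambda>v. ?b (Inl v) - ?b (Inr 0))"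
      unfolding M_mult_vec_of vec_of_eq_iff
      using n_ge_2 by (auto simp: c lap lap_Inl lap_Inr graph_laplace_diff graph_laplace_const card_verts
          sum_subtractf algebra_simps)
    then have "vec_of (\<lambda>v. Poly_Mapping.lookup c (Inl v) - Poly_Mapping.lookup c (Inr 0)) \<in> mat_image M"
      using M_carrier by (auto simp: mat_image_def)
    ultimately show "c \<in> kernel degree0_group (torsion_group \<times>\<times> cok M) cone_hom"
      using deg by (auto simp: kernel_def cone_hom_def cok_class_eq_one_iff[OF M_carrier] intro!: restrict_ext)
  qed
  show "kernel degree0_group (torsion_group \<times>\<times> cok M) cone_hom \<subseteq> laplacian C ` carrier chain_group"
  proof
    fix c assume ker: "c \<in> kernel degree0_group (torsion_group \<times>\<times> cok M) cone_hom"
    let ?c = "Poly_Mapping.lookup c"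
    have deg: "c \<in> carrier degree0_group" using ker by (simp add: kernel_def)
    have one: "cone_hom c = (\<lambda>i\<in>{..<n - 2}. 0, \<one>\<^bsub>cok M\<^esub>)" using ker by (simp add: kernel_def)
    have "?N dvd ?c (Inr (Suc i)) - ?c (Inr 0)" if "i < n - 2" for i
      using fun_cong[OF arg_cong[where f = fst, OF one], of i] that
      by (simp add: cone_hom_def mod_eq_0_iff_dvd)
    then obtain a where a: "\<And>i. i < n - 2 \<Longrightarrow> ?c (Inr (Suc i)) - ?c (Inr 0) = ?N * a i"
      unfolding dvd_def by metis
    have "vec_of (\<lambda>v. ?c (Inl v) - ?c (Inr 0)) \<in> mat_image M"
      using one by (simp add: cone_hom_def cok_class_eq_one_iff[OF M_carrier])
    then obtain u where u: "u \<in> carrier_vec k" "vec_of (\<lambda>v. ?c (Inl v) - ?c (Inr 0)) = M *\<^sub>v u"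
      using M_carrier by (auto simp: mat_image_def)
    obtain f where f: "u = vec_of f" using vec_of_surj[OF u(1)] .
    have cf: "?c (Inl v) - ?c (Inr 0) = graph_laplace G f v + int n * f v + (\<Sum>w\<in>verts G. f w)"
      if "v \<in> verts G" for v
      using u(2) that unfolding f M_mult_vec_of vec_of_eq_iff by blast
    \<comment> \<open>The Laplacian of \<open>b\<close> at \<open>Inr 0\<close>, where \<open>b\<close> vanishes, is minus the total of \<open>b\<close>;
      this dictates the total prescribed here.\<close>
    obtain b where keys: "Poly_Mapping.keys b \<subseteq> verts C"
      and bl: "\<And>v. v \<in> verts G \<Longrightarrow> Poly_Mapping.lookup b (Inl v) = f v"
      and b0: "Poly_Mapping.lookup b (Inr 0) = 0"
      and br: "\<And>i. i < n - 2 \<Longrightarrow> Poly_Mapping.lookup b (Inr (Suc i)) = a i"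
      and sum: "(\<Sum>x\<in>verts C. Poly_Mapping.lookup b x) = - ?c (Inr 0)"
      using exists_chain_with_sum[of f a "- ?c (Inr 0)"] by blast
    let ?g = "Poly_Mapping.lookup b"
    have gl: "(\<Sum>v\<in>verts G. ?g (Inl v)) = (\<Sum>v\<in>verts G. f v)" by (simp add: bl)
    \<comment> \<open>With the opposite sign this sum supplies the all-ones part of \<open>M\<close>
      and the shift by \<open>?c (Inr 0)\<close> in the equations on \<open>G\<close>.\<close>
    have gr: "(\<Sum>i<n. ?g (Inr i)) = - ?c (Inr 0) - (\<Sum>v\<in>verts G. f v)"
      using sum by (simp add: sum_verts_cone gl)
    have Inl: "graph_laplace C ?g (Inl v) = ?c (Inl v)" if v: "v \<in> verts G" for v
    proof -
      have "graph_laplace G (\<lambda>v. ?g (Inl v)) v = graph_laplace G f v"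
        by (rule graph_laplace_cong[OF fin_digraph_axioms v]) (simp add: bl)
      then show ?thesis
        using cf[OF v] v by (simp add: lap_Inl[OF v] gr bl)
    qed
    have Inr: "graph_laplace C ?g (Inr i) = ?c (Inr i)" if "i < n - 1" for i
    proof (cases i)
      case 0
      then show ?thesis using n_ge_2 by (simp add: lap_Inr gl gr b0)
    next
      case (Suc j)
      with that have "j < n - 2" "i < n" by auto
      with Suc a[of j] show ?thesis by (simp add: lap_Inr gl gr br card_verts)
    qed
    \<comment> \<open>Both functions have total 0, so agreement at all other vertices forces
      agreement here.\<close>
    have last: "graph_laplace C ?g (Inr (n - 1)) = ?c (Inr (n - 1))"
    proof (rule eq_if_sum_verts_eq)
      fix x assume "x \<in> verts C" "x \<noteq> Inr (n - 1)"
      then show "graph_laplace C ?g x = ?c x"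
        by (cases rule: verts_cone_cases) (auto simp: Inl Inr)
    next
      show "Inr (n - 1) \<in> verts C" using n_ge_2 by (auto simp: verts_iterated_cone)
      show "(\<Sum>x\<in>verts C. graph_laplace C ?g x) = (\<Sum>x\<in>verts C. ?c x)"
        using deg sum_graph_laplace[OF fin_cone] by (simp add: degree0_iff)
    qed
    have "laplacian C b = c"
    proof (rule poly_mapping_eqI)
      fix x
      show "Poly_Mapping.lookup (laplacian C b) x = ?c x"
      proof (cases "x \<in> verts C")
        case True
        then show ?thesis
          by (cases rule: verts_cone_cases) (use Inl Inr last in \<open>auto simp: lap\<close>)
      next
        case False
        then have "x \<notin> Poly_Mapping.keys (laplacian C b)" "x \<notin> Poly_Mapping.keys c"
          using keys_laplacian[OF fin_cone] deg by (auto simp: degree0_iff)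
        then show ?thesis by (simp add: in_keys_iff)
      qed
    qed
    then show "c \<in> laplacian C ` carrier chain_group" using keys by auto
  qed
qed

text \<open>The first isomorphism theorem: the subgroup divided out in \<open>crit\<close> is the
  kernel of the surjection \<open>cone_hom\<close>.\<close>

theorem crit_iso: "crit C \<cong> torsion_group \<times>\<times> cok M"
proof -
  interpret group_hom degree0_group "torsion_group \<times>\<times> cok M" cone_hom
    by (intro group_hom.intro group_hom_axioms.intro group_degree0 group_target cone_hom_hom)
  show ?thesis
    using FactGroup_iso[OF cone_hom_surj] by (simp add: kernel_cone_hom crit_def)
qed

text \<open>The subgroup is generated by the class of the all-ones vector. By
  \<open>vec_of_const_in_image_iff\<close> its multiples coincide exactly when they agree modulo
  \<open>n + k\<close>.\<close>

theorem cok_subgroup: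
  "\<exists>H. subgroup H (cok M) \<and> (cok M)\<lparr>carrier := H\<rparr> \<cong> integer_mod_group (n + k)"
proof -
  let ?Z = "integer_mod_group (n + k)"
  let ?h = "\<lambda>m. cok_class M (vec_of (\<lambda>_. m))"
  have eq: "?h a = ?h b \<longleftrightarrow> int (n + k) dvd a - b" for a b
    by (simp add: cok_class_eq_iff[OF M_carrier] vec_of_diff vec_of_const_in_image_iff del: of_nat_add)
  have hom: "?h \<in> hom ?Z (cok M)"
  proof (rule homI)
    fix x y
    show "?h (x \<otimes>\<^bsub>?Z\<^esub> y) = ?h x \<otimes>\<^bsub>cok M\<^esub> ?h y"
      by (simp add: mult_cok[OF M_carrier] vec_of_add eq mod_eq_dvd_iff[symmetric] del: of_nat_add)
  qed (auto simp: carrier_cok[OF M_carrier])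
  interpret group_hom ?Z "cok M" ?h
    by (intro group_hom.intro group_hom_axioms.intro group_cok[OF M_carrier] hom) simp
  have "inj_on ?h (carrier ?Z)"
    using n_ge_2 by (auto simp: inj_on_def eq carrier_integer_mod_group mod_eq_dvd_iff[symmetric] simp del: of_nat_add)
  then have "?h \<in> iso ?Z ((cok M)\<lparr>carrier := ?h ` carrier ?Z\<rparr>)"
    using hom by (auto simp: iso_def hom_def bij_betw_def)
  then have "?Z \<cong> (cok M)\<lparr>carrier := ?h ` carrier ?Z\<rparr>" by (auto simp: is_iso_def)
  then have "(cok M)\<lparr>carrier := ?h ` carrier ?Z\<rparr> \<cong> ?Z"
    by (rule group.iso_sym[OF group_integer_mod_group])
  then show ?thesis using img_is_subgroup by blast
qed

text \<open>The torsion factor contributes \<open>(n + k) ^ (n - 2)\<close>, and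
  \<open>det_M\<close> turns the order of the cokernel into the remaining factor. Finiteness is
  stated too, since \<open>Coset.order\<close> is 0 on an infinite carrier.\<close>

theorem order_crit:
  "finite (carrier (crit C))"
  "real (Coset.order (crit C)) =
     \<bar>real_of_int (poly (char_poly (laplacian_mat G vs)) (- int n))\<bar> / real n * real (n + k) ^ (n - 1)"
proof -
  let ?T = "carrier torsion_group \<times> carrier (cok M)"
  let ?p = "poly (char_poly (laplacian_mat G vs)) (- int n)"
  obtain h where h: "bij_betw h (carrier (crit C)) ?T"
    using crit_iso by (auto simp: is_iso_def iso_def)
  have fin: "finite ?T"
    using card_cok(1)[OF M_carrier det_M_nonzero] n_ge_2
    by (auto intro!: finite_PiE simp: carrier_integer_mod_group)
  show "finite (carrier (crit C))" using h fin bij_betw_finite by blast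
  have "Coset.order (crit C) = card ?T"
    using bij_betw_same_card[OF h] by (simp add: Coset.order_def)
  also have "\<dots> = (n + k) ^ (n - 2) * Coset.order (cok M)"
    using n_ge_2 by (simp add: card_cartesian_product card_PiE carrier_integer_mod_group Coset.order_def
        nat_int_add)
  finally have "real (Coset.order (crit C)) = real (n + k) ^ (n - 2) * real (Coset.order (cok M))"
    by simp
  also have "real (Coset.order (cok M)) = real_of_int \<bar>det M\<bar>"
    using card_cok(2)[OF M_carrier det_M_nonzero] by (metis of_int_of_nat_eq)
  also have "\<dots> = real (n + k) * real_of_int \<bar>?p\<bar> / real n"
  proof -
    have "real n * real_of_int \<bar>det M\<bar> = real (n + k) * real_of_int \<bar>?p\<bar>"
      using arg_cong[OF det_M, of real_of_int] by (simp only: of_int_mult of_int_of_nat_eq)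
    then show ?thesis using n_ge_2 by (simp add: field_simps)
  qed
  also have "real (n + k) ^ (n - 2) * (real (n + k) * real_of_int \<bar>?p\<bar> / real n)
      = \<bar>real_of_int ?p\<bar> / real n * real (n + k) ^ (n - 1)"
  proof -
    have "n - 1 = Suc (n - 2)" using n_ge_2 by simp
    then show ?thesis by simp
  qed
  finally show "real (Coset.order (crit C)) = \<bar>real_of_int ?p\<bar> / real n * real (n + k) ^ (n - 1)" .
qed

end

theorem theorem1:
  fixes G :: "('a, 'b) pre_digraph" and vs :: "'a list" and n k :: nat and L :: "int mat"
  assumes "fin_digraph G" and "Digraph_Component.connected G" and "eulerian G"
    and "card (verts G) = k"
    and "distinct vs" and "set vs = verts G"
    and "L = laplacian_mat G vs"
    and "n \<ge> 2"
  shows "crit (iterated_cone n G) \<cong>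
           product_group {..<n - 2} (\<lambda>_. integer_mod_group (n + k))
           \<times>\<times> cok (int n \<cdot>\<^sub>m 1\<^sub>m k + L + ones_mat k)
       \<and> (\<exists>H. subgroup H (cok (int n \<cdot>\<^sub>m 1\<^sub>m k + L + ones_mat k)) \<and>
             (cok (int n \<cdot>\<^sub>m 1\<^sub>m k + L + ones_mat k))\<lparr>carrier := H\<rparr> \<cong> integer_mod_group (n + k))
       \<and> finite (carrier (crit (iterated_cone n G)))
       \<and> real (Coset.order (crit (iterated_cone n G))) =
           \<bar>real_of_int (poly (char_poly L) (- int n))\<bar> / real n * real (n + k) ^ (n - 1)"
proof -
  interpret fin_digraph G by fact
  \<comment> \<open>Connectedness includes a nonempty vertex set, which the maximum principle needs
    in order to pick extrema.\<close>
  have "verts G \<noteq> {}"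
    using assms(2) by (auto simp: Digraph_Component.connected_def strongly_connected_def)
  then interpret eulerian_cone G vs n k using assms by unfold_locales auto
  show ?thesis
    unfolding assms(7) M_def[symmetric] by (intro conjI crit_iso cok_subgroup order_crit)
qed

end
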